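(* Let $p$ be a prime and $w\ge1$. The number of Scopes families of finite cardinality is $\frac1p\binom{pw-2}{p-1}$.
   Context: Let $\mathscr C_p=\{(c_0,\ldots,c_{p-1})\in\mathbb Z^p:\sum c_j=0\}$. For $1\le j\le p-1$, $c\in\mathscr C_p$ is $j$-allowed if $c_j-c_{j-1}\ge w$, and then $\mathrm{sc}_j(c)$ is $c$ with coordinates $c_{j-1}$ and $c_j$ interchanged. $c$ is $0$-allowed if $c_0-c_{p-1}>w$, and then $\mathrm{sc}_0(c)=(c_{p-1}+1,c_1,\ldots,c_{p-2},c_0-1)$. The Scopes families are the equivalence classes of the equivalence relation on $\mathscr C_p$ generated by $c\sim\mathrm{sc}_j(c)$ for all $0\le j\le p-1$ and all $j$-allowed $c$. *)

theory Defs
  imports Complex_Main "HOL-Computational_Algebra.Primes"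
begin

definition charge_vectors :: "nat \<Rightarrow> int list set" where
  "charge_vectors p = {c. length c = p \<and> sum_list c = 0}"

definition scopes_allowed :: "nat \<Rightarrow> nat \<Rightarrow> nat \<Rightarrow> int list \<Rightarrow> bool" where
  "scopes_allowed p w j c \<longleftrightarrow>
     (if j = 0 then c ! 0 - c ! (p - 1) > int w
      else c ! j - c ! (j - 1) \<ge> int w)"

definition scopes_move :: "nat \<Rightarrow> nat \<Rightarrow> int list \<Rightarrow> int list" where
  "scopes_move p j c =
     (if j = 0 then c[0 := c ! (p - 1) + 1, p - 1 := c ! 0 - 1]
      else c[j - 1 := c ! j, j := c ! (j - 1)])"

definition scopes_step :: "nat \<Rightarrow> nat \<Rightarrow> int list \<Rightarrow> int list \<Rightarrow> bool" where
  "scopes_step p w c d \<longleftrightarrow>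
     c \<in> charge_vectors p \<and> (\<exists>j<p. scopes_allowed p w j c \<and> d = scopes_move p j c)"

definition scopes_rel :: "nat \<Rightarrow> nat \<Rightarrow> (int list \<times> int list) set" where
  "scopes_rel p w =
     {(c, d). c \<in> charge_vectors p \<and> d \<in> charge_vectors p \<and> equivclp (scopes_step p w) c d}"

definition scopes_families :: "nat \<Rightarrow> nat \<Rightarrow> int list set set" where
  "scopes_families p w = charge_vectors p // scopes_rel p w"

end

theory Submission
  imports Defs
begin

text \<open>Reversed Scopes moves (raises) increase a positive potential and, by the commutation and braid
  relations, are locally confluent. Hence a family is finite if and only if it contains a vector
  that cannot be raised, and then this vector is unique: every member is obtained from it by
  Scopes moves. The slacks in the \<open>p\<close> inequalities saying that \<open>c\<close> cannot be raised form a weak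
  composition \<open>e\<close> of \<open>p(w - 1) - 1\<close> into \<open>p\<close> parts, and the compositions that arise are those for
  which the moment \<open>0 e\<^sub>0 + 1 e\<^sub>1 + \<dots> + (p - 1) e\<^bsub>p-1\<^esub>\<close> lies in one fixed residue class modulo \<open>p\<close>. Rotation
  shifts the moment by 1 modulo \<open>p\<close>, so exactly one \<open>p\<close>-th of all compositions arise.\<close>

section \<open>Relations with locally confluent converse\<close>

text \<open>A variant of Newman's lemma for the converse of \<open>r\<close>. The potential
  \<open>\<phi>\<close> has no global upper bound, but \<open>\<phi> x\<close> bounds it on
  everything reachable from \<open>x\<close>. This suffices to show that the reachable set is closed
  under predecessors, so a zigzag starting at \<open>x\<close> never leaves it.\<close>

lemma equivclp_imp_rtranclp_from_source:
  fixes r :: "'a \<Rightarrow> 'a \<Rightarrow> bool" and \<phi> :: "'a \<Rightarrow> nat"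
  assumes decr: "\<And>c d. r c d \<Longrightarrow> \<phi> d < \<phi> c"
    and confl: "\<And>y z z'. r z y \<Longrightarrow> r z' y \<Longrightarrow> z \<noteq> z' \<Longrightarrow> \<exists>u. r\<^sup>*\<^sup>* u z \<and> r\<^sup>*\<^sup>* u z'"
    and source: "\<And>d. \<not> r d x"
    and eq: "equivclp r x y"
  shows "r\<^sup>*\<^sup>* x y"
proof -
  have mono: "\<phi> d \<le> \<phi> c" if "r\<^sup>*\<^sup>* c d" for c d
    using that by induction (auto dest: decr)
  have up: "r\<^sup>*\<^sup>* x z" if "r\<^sup>*\<^sup>* x y" "r z y" for y z
    using that
  proof (induction "\<phi> x - \<phi> y" arbitrary: y z rule: less_induct)
    case less
    \<comment> \<open>The vertex \<open>y\<close> has the predecessor \<open>z\<close>, so it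
      differs from the source \<open>x\<close> and the path from \<open>x\<close> has a last
      step.\<close>
    from less.prems source obtain y' where y': "r\<^sup>*\<^sup>* x y'" "r y' y"
      by (metis rtranclp.cases)
    show ?case
    proof (cases "z = y'")
      case False
      then obtain u where u: "r\<^sup>*\<^sup>* u z" "r\<^sup>*\<^sup>* u y'"
        using confl less.prems(2) y'(2) by blast
      \<comment> \<open>Walk back from \<open>y'\<close> to \<open>u\<close>. Each vertex
        \<open>a\<close> on the way is reachable from \<open>x\<close> and has larger potential than
        \<open>y\<close>, so the outer induction hypothesis reaches its predecessor.\<close>
      from u(2) have "r\<^sup>*\<^sup>* x u"
      proof (induction rule: converse_rtranclp_induct)
        case (step u a)
        have "\<phi> y < \<phi> a"
          using decr[OF y'(2)] mono[OF step.hyps(2)] by simp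
        moreover have "\<phi> a \<le> \<phi> x" using mono[OF step.IH] .
        ultimately have "\<phi> x - \<phi> a < \<phi> x - \<phi> y" by simp
        from less.hyps[OF this step.IH step.hyps(1)] show ?case .
      qed (use y' in simp)
      then show ?thesis using u(1) by simp
    qed (use y' in simp)
  qed
  from eq show ?thesis
    by (induction rule: equivclp_induct) (auto intro: up rtranclp.rtrancl_into_rtrancl)
qed

section \<open>Scopes moves as exchanges\<close>

definition cyc_pred :: "nat \<Rightarrow> nat \<Rightarrow> nat" where
  "cyc_pred p j = (if j = 0 then p - 1 else j - 1)"

text \<open>Absorbs both special features of the index 0: the strict inequality in the condition and
  the shift by 1 in the move.\<close>

definition carry :: "nat \<Rightarrow> int" where
  "carry j = (if j = 0 then 1 else 0)"

definition exchange :: "nat \<Rightarrow> nat \<Rightarrow> int \<Rightarrow> int list \<Rightarrow> int list" where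
  "exchange i j t c = c[i := c ! j - t, j := c ! i + t]"

lemma length_exchange [simp]: "length (exchange i j t c) = length c"
  by (simp add: exchange_def)

lemma nth_exchange:
  assumes "i < length c" "j < length c" "i \<noteq> j" "k < length c"
  shows "exchange i j t c ! k = (if k = i then c ! j - t else if k = j then c ! i + t else c ! k)"
  using assms by (auto simp: exchange_def nth_list_update)

lemma exchange_exchange:
  assumes "i < length c" "j < length c" "i \<noteq> j"
  shows "exchange i j t (exchange i j t c) = c"
  using assms by (intro nth_equalityI) (auto simp: nth_exchange)

lemma exchange_commute:
  assumes "i < length c" "j < length c" "k < length c" "l < length c" "distinct [i, j, k, l]"
  shows "exchange i j t (exchange k l s c) = exchange k l s (exchange i j t c)"
  using assms by (intro nth_equalityI) (auto simp: nth_exchange)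

text \<open>Exchanges with offsets are reflections of affine type. Both sides reverse the three
  coordinates, with total offset \<open>t + s\<close> at the ends and none in the middle.\<close>

lemma exchange_braid:
  assumes "i < length c" "j < length c" "k < length c" "distinct [i, j, k]"
  shows "exchange i j t (exchange j k s (exchange i j t c)) =
         exchange j k s (exchange i j t (exchange j k s c))"
  using assms by (intro nth_equalityI) (auto simp: nth_exchange)

text \<open>The summand may depend on the index so that one formula serves both the total charge and
  the potential.\<close>

lemma sum_exchange:
  fixes f :: "nat \<Rightarrow> int \<Rightarrow> int"
  assumes "i < length c" "j < length c" "i \<noteq> j"
  shows "(\<Sum>k<length c. f k (exchange i j t c ! k)) =
         (\<Sum>k<length c. f k (c ! k)) - f i (c ! i) - f j (c ! j) + f i (c ! j - t) + f j (c ! i + t)"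
proof -
  let ?R = "{..<length c} - {i, j}"
  have split: "(\<Sum>k<length c. g k) = g i + g j + (\<Sum>k\<in>?R. g k)" for g :: "nat \<Rightarrow> int"
    using assms sum.subset_diff[of "{i, j}" "{..<length c}" g] by simp
  have "(\<Sum>k\<in>?R. f k (exchange i j t c ! k)) = (\<Sum>k\<in>?R. f k (c ! k))"
    using assms by (intro sum.cong) (auto simp: nth_exchange)
  then show ?thesis
    using assms by (simp add: split nth_exchange)
qed

lemma sum_list_exchange:
  assumes "i < length c" "j < length c" "i \<noteq> j"
  shows "sum_list (exchange i j t c) = sum_list c"
  using sum_exchange[OF assms, of "\<lambda>k x. x" t]
  by (simp add: sum_list_sum_nth atLeast0LessThan)

lemma cyc_pred_less [simp]: "j < p \<Longrightarrow> cyc_pred p j < p"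
  by (auto simp: cyc_pred_def)

lemma cyc_pred_neq: "p \<ge> 2 \<Longrightarrow> j < p \<Longrightarrow> cyc_pred p j \<noteq> j"
  by (auto simp: cyc_pred_def)

lemma cyc_pred_inj: "j < p \<Longrightarrow> k < p \<Longrightarrow> cyc_pred p j = cyc_pred p k \<Longrightarrow> j = k"
  by (auto simp: cyc_pred_def split: if_splits)

lemma scopes_move_eq_exchange:
  assumes "p \<ge> 2" "j < p"
  shows "scopes_move p j c = exchange (cyc_pred p j) j (carry j) c"
  using assms by (auto simp: scopes_move_def exchange_def cyc_pred_def carry_def list_update_swap)

lemma scopes_allowed_iff:
  "scopes_allowed p w j c \<longleftrightarrow> c ! j - c ! cyc_pred p j \<ge> int w + carry j"
  by (auto simp: scopes_allowed_def cyc_pred_def carry_def)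

lemma scopes_move_charge_vectors:
  assumes "p \<ge> 2" "j < p" "c \<in> charge_vectors p"
  shows "scopes_move p j c \<in> charge_vectors p"
  using assms cyc_pred_neq[of p j]
  by (auto simp: scopes_move_eq_exchange charge_vectors_def sum_list_exchange)

lemma scopes_step_charge_vectors:
  assumes "p \<ge> 2" "scopes_step p w c d"
  shows "c \<in> charge_vectors p" "d \<in> charge_vectors p"
  using assms scopes_move_charge_vectors by (auto simp: scopes_step_def)

section \<open>Raises, the reversed Scopes moves\<close>

definition raisable :: "nat \<Rightarrow> nat \<Rightarrow> nat \<Rightarrow> int list \<Rightarrow> bool" where
  "raisable p w j c \<longleftrightarrow> c ! cyc_pred p j + carry j - c ! j \<ge> int w"

text \<open>Each move is an involution that interchanges \<open>scopes_allowed\<close> and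
  \<open>raisable\<close>, so the steps into \<open>c\<close> are found by applying the same moves
  to \<open>c\<close>.\<close>

lemma scopes_step_iff_raise:
  assumes "p \<ge> 2"
  shows "scopes_step p w d c \<longleftrightarrow>
    c \<in> charge_vectors p \<and> (\<exists>j<p. raisable p w j c \<and> d = scopes_move p j c)" (is "?L \<longleftrightarrow> ?R")
proof -
  have inv: "scopes_move p j (scopes_move p j c) = c"
    if "j < p" "c \<in> charge_vectors p" for j c
    using that assms cyc_pred_neq[OF assms that(1)]
    by (simp add: scopes_move_eq_exchange exchange_exchange charge_vectors_def)
  have dual: "raisable p w j (scopes_move p j c) \<longleftrightarrow> scopes_allowed p w j c"
    "scopes_allowed p w j (scopes_move p j c) \<longleftrightarrow> raisable p w j c"
    if "j < p" "c \<in> charge_vectors p" for j c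
    using that assms cyc_pred_neq[OF assms that(1)]
    by (auto simp: scopes_move_eq_exchange raisable_def scopes_allowed_iff nth_exchange
        charge_vectors_def)
  show ?thesis
    unfolding scopes_step_def
    using inv dual scopes_move_charge_vectors[OF assms] by metis
qed

section \<open>The potential\<close>

text \<open>The numbers \<open>p * c ! j + j\<close> are the bead positions on an abacus with \<open>p\<close> runners. A raise moves
  two beads one position apart from each other, so it increases the sum of their squares.\<close>

definition potential :: "nat \<Rightarrow> int list \<Rightarrow> nat" where
  "potential p c = nat (\<Sum>j<length c. (int p * c ! j + int j)\<^sup>2)"

lemma potential_step:
  assumes "p \<ge> 2" "w \<ge> 1" "scopes_step p w d c"
  shows "potential p c < potential p d"
proof -
  obtain j where j: "j < p" "raisable p w j c" "d = exchange (cyc_pred p j) j (carry j) c"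
    and c: "length c = p"
    using assms by (auto simp: scopes_step_iff_raise scopes_move_eq_exchange charge_vectors_def)
  define x y where "x = int p * c ! cyc_pred p j + int (cyc_pred p j)"
    and "y = int p * c ! j + int j"
  \<comment> \<open>For \<open>j = 0\<close> the carry supplies a full row of length
    \<open>p\<close>, which compensates the drop from runner \<open>p - 1\<close> to runner
    0.\<close>
  have pos: "int p * (c ! cyc_pred p j + carry j) + int j = x + 1"
    "int p * (c ! j - carry j) + int (cyc_pred p j) = y - 1"
    using j(1) by (auto simp: x_def y_def cyc_pred_def carry_def algebra_simps of_nat_diff)
  have "(\<Sum>k<length d. (int p * d ! k + int k)\<^sup>2)
      = (\<Sum>k<length c. (int p * c ! k + int k)\<^sup>2) - x\<^sup>2 - y\<^sup>2 + (y - 1)\<^sup>2 + (x + 1)\<^sup>2"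
    using sum_exchange[of "cyc_pred p j" c j "\<lambda>k x. (int p * x + int k)\<^sup>2" "carry j"]
      c j cyc_pred_neq[OF assms(1) j(1)] pos
    by (simp add: x_def y_def)
  moreover have "(y - 1)\<^sup>2 + (x + 1)\<^sup>2 - x\<^sup>2 - y\<^sup>2 = 2 * (x - y + 1)"
    by (simp add: power2_eq_square algebra_simps)
  moreover have "x - y + 1 > 0"
  proof -
    have "x + 1 - y = int p * (c ! cyc_pred p j + carry j - c ! j)"
      using pos(1) by (simp add: y_def algebra_simps)
    moreover have "c ! cyc_pred p j + carry j - c ! j > 0"
      using j(2) assms(2) by (simp add: raisable_def)
    ultimately have "x + 1 - y > 0"
      using assms(1) by simp
    then show ?thesis by simp
  qed
  ultimately have "(\<Sum>k<length c. (int p * c ! k + int k)\<^sup>2) < (\<Sum>k<length d. (int p * d ! k + int k)\<^sup>2)"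
    by (smt (verit))
  moreover have "(\<Sum>k<length c. (int p * c ! k + int k)\<^sup>2) \<ge> 0"
    by (intro sum_nonneg) auto
  ultimately show ?thesis
    by (simp add: potential_def)
qed

lemma abs_le_square_int:
  fixes b :: int
  shows "\<bar>b\<bar> \<le> b\<^sup>2"
proof (cases "b = 0")
  case False
  then have "1 \<le> \<bar>b\<bar>" by simp
  from self_le_power[OF this, of 2] show ?thesis by simp
qed simp

text \<open>The potential dominates the square of each bead position, so it bounds every
  coordinate.\<close>

lemma finite_potential_le:
  assumes "p \<ge> 1"
  shows "finite {c \<in> charge_vectors p. potential p c \<le> K}"
proof (rule finite_subset)
  let ?A = "{- int K - int p .. int K + int p}"
  show "{c \<in> charge_vectors p. potential p c \<le> K} \<subseteq> {c. set c \<subseteq> ?A \<and> length c = p}"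
  proof (intro subsetI CollectI conjI)
    fix c x assume c: "c \<in> {c \<in> charge_vectors p. potential p c \<le> K}" and "x \<in> set c"
    then obtain j where j: "j < p" "x = c ! j" and len: "length c = p"
      by (auto simp: charge_vectors_def in_set_conv_nth)
    let ?b = "int p * c ! j + int j"
    have "?b\<^sup>2 \<le> (\<Sum>k<length c. (int p * c ! k + int k)\<^sup>2)"
      using j len by (intro member_le_sum) auto
    also have "\<dots> \<le> int K"
      using c by (simp add: potential_def nat_le_iff)
    finally have "?b\<^sup>2 \<le> int K" .
    moreover have "\<bar>?b\<bar> \<le> ?b\<^sup>2"
      by (rule abs_le_square_int)
    ultimately have b: "\<bar>?b\<bar> \<le> int K" by linarith
    have "\<bar>x\<bar> \<le> \<bar>int p * x\<bar>"
      using assms by (simp add: abs_mult mult_le_cancel_right1)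
    also have "\<dots> \<le> int K + int p" using b j(1) unfolding j(2) by linarith
    finally show "x \<in> ?A" by auto
  qed (auto simp: charge_vectors_def)
  show "finite {c. set c \<subseteq> ?A \<and> length c = p}"
    by (rule finite_lists_length_eq) simp
qed

section \<open>Local confluence of raises\<close>

text \<open>The two raises are completed to the two sides of a braid relation, whose common value is
  \<open>u\<close>.\<close>

lemma raises_adjacent_join:
  assumes "p \<ge> 2" "w \<ge> 1" "y \<in> charge_vectors p" "k < p" "j = cyc_pred p k"
    and "raisable p w j y" "raisable p w k y"
  shows "\<exists>u. (scopes_step p w)\<^sup>*\<^sup>* u (scopes_move p j y) \<and> (scopes_step p w)\<^sup>*\<^sup>* u (scopes_move p k y)"
proof -
  define i where "i = cyc_pred p j"
  have lt: "i < p" "j < p" "k < p" and len: "length y = p"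
    using assms by (auto simp: i_def charge_vectors_def)
  \<comment> \<open>Equality means that \<open>j\<close> and \<open>k\<close> precede each other, as
    happens for \<open>p = 2\<close>. Adding the two raise conditions would then give carries of
    total at least \<open>2 * w\<close>, but at most one of them is 1.\<close>
  have "i \<noteq> k"
  proof
    assume "i = k"
    then have "y ! k + carry j - y ! j \<ge> int w" "y ! j + carry k - y ! k \<ge> int w"
      using assms by (auto simp: raisable_def i_def)
    moreover have "carry j + carry k \<le> 1"
      using cyc_pred_neq[OF assms(1) lt(3)] assms(5) unfolding carry_def by presburger
    ultimately show False using assms(2) by linarith
  qed
  then have d: "distinct [i, j, k]"
    using cyc_pred_neq[OF assms(1)] lt assms(5) by (auto simp: i_def)
  note cv = scopes_move_charge_vectors[OF assms(1)]
  have mj: "scopes_move p j c = exchange i j (carry j) c" for c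
    using lt assms(1) by (simp add: scopes_move_eq_exchange i_def)
  have mk: "scopes_move p k c = exchange j k (carry k) c" for c
    using lt assms(1,5) by (simp add: scopes_move_eq_exchange)
  have rj: "raisable p w j c \<longleftrightarrow> c ! i + carry j - c ! j \<ge> int w" for c
    by (simp add: raisable_def i_def)
  have rk: "raisable p w k c \<longleftrightarrow> c ! j + carry k - c ! k \<ge> int w" for c
    by (simp add: raisable_def assms(5))
  have carry: "carry j \<ge> 0" "carry k \<ge> 0" by (auto simp: carry_def)
  have up: "scopes_step p w (scopes_move p l c) c"
    if "l < p" "c \<in> charge_vectors p" "raisable p w l c" for l c
    using that assms(1) by (auto simp: scopes_step_iff_raise)
  have y: "y ! i + carry j - y ! j \<ge> int w" "y ! j + carry k - y ! k \<ge> int w"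
    using assms(6,7) by (auto simp: rj rk)
  \<comment> \<open>On either side of the braid, the second raise is allowed by the sum of the two
    conditions in \<open>y\<close>, which gives \<open>2 * w\<close>. The third is allowed by the
    original condition of the index that was not raised first.\<close>
  have "(scopes_step p w)\<^sup>*\<^sup>* (scopes_move p j (scopes_move p k (scopes_move p j y))) (scopes_move p j y)"
  proof (rule converse_rtranclp_into_rtranclp[OF _ r_into_rtranclp])
    show "scopes_step p w (scopes_move p k (scopes_move p j y)) (scopes_move p j y)"
      using lt len d y carry assms(2) by (intro up cv assms(3)) (auto simp: mj rk nth_exchange)
    show "scopes_step p w (scopes_move p j (scopes_move p k (scopes_move p j y)))
        (scopes_move p k (scopes_move p j y))"
      using lt len d y carry assms(2) by (intro up cv assms(3)) (auto simp: mj mk rj nth_exchange)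
  qed
  moreover have "(scopes_step p w)\<^sup>*\<^sup>* (scopes_move p k (scopes_move p j (scopes_move p k y))) (scopes_move p k y)"
  proof (rule converse_rtranclp_into_rtranclp[OF _ r_into_rtranclp])
    show "scopes_step p w (scopes_move p j (scopes_move p k y)) (scopes_move p k y)"
      using lt len d y carry assms(2) by (intro up cv assms(3)) (auto simp: mk rj nth_exchange)
    show "scopes_step p w (scopes_move p k (scopes_move p j (scopes_move p k y)))
        (scopes_move p j (scopes_move p k y))"
      using lt len d y carry assms(2) by (intro up cv assms(3)) (auto simp: mj mk rk nth_exchange)
  qed
  moreover have "scopes_move p j (scopes_move p k (scopes_move p j y)) =
      scopes_move p k (scopes_move p j (scopes_move p k y))"
    unfolding mj mk using lt len d by (intro exchange_braid) auto
  ultimately show ?thesis by metis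
qed

text \<open>The raises touch disjoint pairs of coordinates, so they commute and neither affects the
  condition of the other.\<close>

lemma raises_far_join:
  assumes "p \<ge> 2" "y \<in> charge_vectors p" "j < p" "k < p"
    and "distinct [cyc_pred p j, j, cyc_pred p k, k]"
    and "raisable p w j y" "raisable p w k y"
  shows "\<exists>u. (scopes_step p w)\<^sup>*\<^sup>* u (scopes_move p j y) \<and> (scopes_step p w)\<^sup>*\<^sup>* u (scopes_move p k y)"
proof -
  have len: "length y = p" using assms(2) by (simp add: charge_vectors_def)
  have mv: "scopes_move p l c = exchange (cyc_pred p l) l (carry l) c" if "l < p" for l c
    using that assms(1) by (simp add: scopes_move_eq_exchange)
  have raise: "raisable p w k (scopes_move p j y)" "raisable p w j (scopes_move p k y)"
    using assms len by (auto simp: raisable_def mv nth_exchange)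
  have "scopes_move p j (scopes_move p k y) = scopes_move p k (scopes_move p j y)"
    using assms len by (simp add: mv exchange_commute)
  moreover have "scopes_step p w (scopes_move p k (scopes_move p j y)) (scopes_move p j y)"
    "scopes_step p w (scopes_move p j (scopes_move p k y)) (scopes_move p k y)"
    using raise assms scopes_move_charge_vectors[OF assms(1)] by (auto simp: scopes_step_iff_raise)
  ultimately show ?thesis by (metis r_into_rtranclp)
qed

lemma scopes_step_converse_confluent:
  assumes "p \<ge> 2" "w \<ge> 1" "scopes_step p w z y" "scopes_step p w z' y" "z \<noteq> z'"
  shows "\<exists>u. (scopes_step p w)\<^sup>*\<^sup>* u z \<and> (scopes_step p w)\<^sup>*\<^sup>* u z'"
proof -
  obtain j k where jk: "j < p" "raisable p w j y" "z = scopes_move p j y"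
    "k < p" "raisable p w k y" "z' = scopes_move p k y" and y: "y \<in> charge_vectors p"
    using assms by (auto simp: scopes_step_iff_raise)
  have "j \<noteq> k" using jk assms(5) by auto
  moreover have "cyc_pred p j \<noteq> j" "cyc_pred p k \<noteq> k" "cyc_pred p j \<noteq> cyc_pred p k"
    using \<open>j \<noteq> k\<close> cyc_pred_inj[of j p k] cyc_pred_neq[OF assms(1)] jk by auto
  \<comment> \<open>Two different indices have different predecessors, so the pairs can overlap only
    when one index precedes the other.\<close>
  ultimately consider "j = cyc_pred p k" | "k = cyc_pred p j" | "distinct [cyc_pred p j, j, cyc_pred p k, k]"
    by auto
  then show ?thesis
  proof cases
    case 1
    then show ?thesis using raises_adjacent_join[OF assms(1,2) y jk(4)] jk by blast
  next
    case 2
    then show ?thesis using raises_adjacent_join[OF assms(1,2) y jk(1)] jk by blast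
  next
    case 3
    then show ?thesis using raises_far_join[OF assms(1) y jk(1,4)] jk by blast
  qed
qed

section \<open>Finite families and unraisable vectors\<close>

definition unraisable :: "nat \<Rightarrow> nat \<Rightarrow> int list set" where
  "unraisable p w = {c \<in> charge_vectors p. \<forall>j<p. \<not> raisable p w j c}"

lemma unraisable_no_step:
  assumes "p \<ge> 2" "c \<in> charge_vectors p"
  shows "c \<in> unraisable p w \<longleftrightarrow> (\<forall>d. \<not> scopes_step p w d c)"
  using assms by (auto simp: unraisable_def scopes_step_iff_raise)

lemma equiv_scopes_rel: "equiv (charge_vectors p) (scopes_rel p w)"
  by (rule equivI)
    (auto simp: refl_on_def scopes_rel_def intro: symI transI equivclp_sym equivclp_trans)

lemma unraisable_class:
  assumes "p \<ge> 2" "w \<ge> 1" "x \<in> unraisable p w" "(x, y) \<in> scopes_rel p w"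
  shows "(scopes_step p w)\<^sup>*\<^sup>* x y"
proof (rule equivclp_imp_rtranclp_from_source[where \<phi> = "potential p"])
  show "\<not> scopes_step p w d x" for d
    using assms unraisable_no_step[OF assms(1)] by (auto simp: unraisable_def)
  show "equivclp (scopes_step p w) x y" using assms(4) by (simp add: scopes_rel_def)
qed (use assms potential_step scopes_step_converse_confluent in auto)

lemma potential_rtranclp:
  assumes "p \<ge> 2" "w \<ge> 1" "(scopes_step p w)\<^sup>*\<^sup>* x y"
  shows "potential p y \<le> potential p x"
  using assms(3) by induction (auto dest: potential_step[OF assms(1,2)])

text \<open>An unraisable vector has the largest potential in its class, which makes the class
  finite. Conversely, a member of maximal potential in a finite class is unraisable, since a raise
  would stay in the class.\<close>

lemma finite_families_bij:
  assumes "p \<ge> 2" "w \<ge> 1"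
  shows "bij_betw (\<lambda>c. scopes_rel p w `` {c}) (unraisable p w) {F \<in> scopes_families p w. finite F}"
    (is "bij_betw ?cl _ _")
proof (rule bij_betw_imageI)
  have same: "x = y" if "x \<in> unraisable p w" "y \<in> unraisable p w" "(x, y) \<in> scopes_rel p w" for x y
  proof -
    have "(scopes_step p w)\<^sup>*\<^sup>* x y" using unraisable_class[OF assms that(1,3)] .
    moreover have "\<not> scopes_step p w d y" for d
      using that(2) unraisable_no_step[OF assms(1)] by (auto simp: unraisable_def)
    ultimately show ?thesis by (metis rtranclp.cases)
  qed
  show "inj_on ?cl (unraisable p w)"
  proof (rule inj_onI)
    fix x y assume xy: "x \<in> unraisable p w" "y \<in> unraisable p w" "?cl x = ?cl y"
    then have "(x, y) \<in> scopes_rel p w"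
      using eq_equiv_class[OF xy(3) equiv_scopes_rel] by (auto simp: unraisable_def)
    then show "x = y" using same xy by blast
  qed
  show "?cl ` unraisable p w = {F \<in> scopes_families p w. finite F}"
  proof (intro equalityI subsetI)
    fix F assume "F \<in> ?cl ` unraisable p w"
    then obtain x where x: "x \<in> unraisable p w" "F = ?cl x" by auto
    then have "F \<in> scopes_families p w"
      by (auto simp: scopes_families_def unraisable_def intro: quotientI)
    moreover have "F \<subseteq> {c \<in> charge_vectors p. potential p c \<le> potential p x}"
      using x unraisable_class[OF assms x(1)] potential_rtranclp[OF assms]
      by (auto simp: scopes_rel_def)
    then have "finite F"
      using finite_potential_le[of p] assms(1) finite_subset by fastforce
    ultimately show "F \<in> {F \<in> scopes_families p w. finite F}" by simp
  next
    fix F assume "F \<in> {F \<in> scopes_families p w. finite F}"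
    then obtain c where c: "c \<in> charge_vectors p" "F = ?cl c" "finite F"
      by (auto simp: scopes_families_def elim: quotientE)
    then have "c \<in> F"
      using equiv_class_self[OF equiv_scopes_rel] by blast
    then obtain x where x: "x \<in> F" "\<And>y. y \<in> F \<Longrightarrow> potential p y \<le> potential p x"
      using Max_in[of "potential p ` F"] Max_ge[of "potential p ` F"] c(3) by fastforce
    have xc: "x \<in> charge_vectors p" "(c, x) \<in> scopes_rel p w"
      using x(1) c by (auto simp: scopes_rel_def)
    have "\<not> scopes_step p w d x" for d
    proof
      assume d: "scopes_step p w d x"
      have "equivclp (scopes_step p w) c d"
        using xc(2) d by (auto simp: scopes_rel_def intro: equivclp_into_equivclp)
      then have "d \<in> F"
        using c scopes_step_charge_vectors[OF assms(1) d] by (auto simp: scopes_rel_def)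
      then show False using x(2) potential_step[OF assms d] by fastforce
    qed
    then have "x \<in> unraisable p w" using unraisable_no_step[OF assms(1) xc(1)] by blast
    moreover have "F = ?cl x"
      using equiv_class_eq[OF equiv_scopes_rel xc(2)] c(2) by simp
    ultimately show "F \<in> ?cl ` unraisable p w" by blast
  qed
qed

section \<open>Counting the unraisable vectors\<close>

definition moment :: "nat list \<Rightarrow> nat" where
  "moment e = (\<Sum>j<length e. j * e ! j)"

lemma moment_Cons: "moment (x # xs) = moment xs + sum_list xs"
  by (simp add: moment_def sum.lessThan_Suc_shift sum_list_sum_nth atLeast0LessThan
      sum.distrib add.commute del: sum.lessThan_Suc)

lemma moment_snoc: "moment (xs @ [x]) = moment xs + length xs * x"
  by (simp add: moment_def nth_append)

text \<open>Rotation lowers every index by 1, which costs \<open>sum_list e\<close>, except that the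
  head wraps from index 0 to the end and so gains \<open>length e * hd e\<close> in comparison. The
  additive form avoids truncated subtraction.\<close>

lemma moment_rotate1:
  assumes "e \<noteq> []"
  shows "moment (rotate1 e) + sum_list e = moment e + length e * hd e"
  using assms by (cases e) (auto simp: moment_Cons moment_snoc)

definition moment_class :: "nat \<Rightarrow> nat \<Rightarrow> nat \<Rightarrow> nat list set" where
  "moment_class p N r = {e. length e = p \<and> sum_list e = N \<and> moment e mod p = r mod p}"

lemma finite_lists_sum: "finite {e :: nat list. length e = p \<and> sum_list e = N}"
  by (rule finite_subset[OF _ finite_lists_length_eq[of "{..N}" p]])
    (auto dest: member_le_sum_list)

lemma finite_moment_class: "finite (moment_class p N r)"
  by (rule finite_subset[OF _ finite_lists_sum[of p N]]) (auto simp: moment_class_def)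

text \<open>Rotation subtracts \<open>N\<close> from the moment modulo \<open>p\<close>, and
  \<open>N\<close> is congruent to -1.\<close>

lemma card_moment_class_le:
  assumes "p \<ge> 1" "p dvd N + 1"
  shows "card (moment_class p N r) \<le> card (moment_class p N (Suc r))"
proof (rule card_inj_on_le[of rotate1])
  show "inj_on rotate1 (moment_class p N r)"
    using inj_on_subset[OF inj_rotate1] by blast
  show "rotate1 ` moment_class p N r \<subseteq> moment_class p N (Suc r)"
  proof clarify
    fix e assume e: "e \<in> moment_class p N r"
    obtain q where q: "N + 1 = p * q" using assms(2) by auto
    have "e \<noteq> []" using e assms(1) by (auto simp: moment_class_def)
    then have "moment (rotate1 e) + p * q = moment e + 1 + p * hd e"
      using moment_rotate1[of e] e q by (simp add: moment_class_def)
    then have "moment (rotate1 e) mod p = (moment e + 1) mod p"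
      by (metis mod_mult_self2)
    also have "\<dots> = Suc r mod p"
      using e by (simp add: moment_class_def) (metis mod_Suc_eq)
    finally show "rotate1 e \<in> moment_class p N (Suc r)"
      using e by (cases e) (auto simp: moment_class_def)
  qed
qed (rule finite_moment_class)

text \<open>The class sizes are nondecreasing in \<open>r\<close> and periodic with period
  \<open>p\<close>, hence constant. The classes therefore split all weak compositions evenly, and
  stars and bars gives the total.\<close>

lemma card_moment_class:
  assumes "p \<ge> 1" "p dvd N + 1"
  shows "p * card (moment_class p N r) = (N + p - 1) choose N"
proof -
  have mono: "card (moment_class p N a) \<le> card (moment_class p N b)" if "a \<le> b" for a b
    using lift_Suc_mono_le[of "\<lambda>r. card (moment_class p N r)", OF card_moment_class_le[OF assms] that] .
  have per: "moment_class p N (a mod p) = moment_class p N a" "moment_class p N p = moment_class p N 0" for a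
    by (auto simp: moment_class_def)
  have all: "card (moment_class p N a) = card (moment_class p N 0)" for a
  proof -
    have "card (moment_class p N (a mod p)) \<le> card (moment_class p N p)"
      using assms(1) by (intro mono) (simp add: less_imp_le)
    then show ?thesis using mono[of 0 a] unfolding per by simp
  qed
  have "{e. length e = p \<and> sum_list e = N} = (\<Union>r<p. moment_class p N r)"
    using assms(1) mod_less_divisor[of p] by (fastforce simp: moment_class_def)
  then have "card {e. length e = p \<and> sum_list e = N} = (\<Sum>r<p. card (moment_class p N r))"
    by (simp only:, intro card_UN_disjoint) (auto simp: finite_moment_class, auto simp: moment_class_def)
  also have "\<dots> = p * card (moment_class p N r)"
  proof -
    have "card (moment_class p N a) = card (moment_class p N r)" for a
      using all[of a] all[of r] by (rule trans[OF _ sym])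
    then have "(\<Sum>a<p. card (moment_class p N a)) = (\<Sum>a<p. card (moment_class p N r))"
      by (intro sum.cong refl)
    then show ?thesis by (simp only: sum_constant card_lessThan of_nat_id)
  qed
  finally show ?thesis
    by (simp add: card_length_sum_list)
qed

section \<open>Charge vectors coded by their cyclic gaps\<close>

lemma sum_partial_sums:
  fixes g :: "nat \<Rightarrow> int"
  shows "(\<Sum>j<n. \<Sum>i\<le>j. g i) = int n * (\<Sum>i<n. g i) - (\<Sum>i<n. int i * g i)"
  by (induction n) (auto simp: lessThan_Suc_atMost[symmetric] algebra_simps)

text \<open>The bead positions at \<open>j\<close> and \<open>cyc_pred p j\<close> differ by
  \<open>p * gap p c j + 1\<close>; being raisable at \<open>j\<close> means a gap of at most
  \<open>- w\<close>.\<close>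

definition gap :: "nat \<Rightarrow> int list \<Rightarrow> nat \<Rightarrow> int" where
  "gap p c j = c ! j - c ! cyc_pred p j - carry j"

lemma sum_gap:
  assumes "j < p"
  shows "(\<Sum>i\<le>j. gap p c i) = c ! j - c ! (p - 1) - 1"
  using assms by (induction j) (auto simp: gap_def cyc_pred_def carry_def)

lemma sum_gap_all: "p \<ge> 1 \<Longrightarrow> (\<Sum>i<p. gap p c i) = - 1"
  using sum_gap[of "p - 1" p c] by (cases p) (auto simp: lessThan_Suc_atMost)

text \<open>Abel summation turns the moment into a sum of partial sums, which telescope to
  coordinates. As the charges sum to 0, only the last coordinate survives, multiplied by
  \<open>p\<close>.\<close>

lemma moment_gap:
  assumes "p \<ge> 1" "c \<in> charge_vectors p"
  shows "(\<Sum>i<p. int i * gap p c i) = int p * c ! (p - 1)"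
proof -
  have "(\<Sum>j<p. \<Sum>i\<le>j. gap p c i) = (\<Sum>j<p. c ! j) - int p * (c ! (p - 1) + 1)"
    by (simp add: sum_gap sum_subtractf algebra_simps)
  also have "(\<Sum>j<p. c ! j) = 0"
    using assms(2) by (auto simp: charge_vectors_def sum_list_sum_nth atLeast0LessThan)
  finally show ?thesis
    using sum_partial_sums[of "gap p c" p] sum_gap_all[OF assms(1), of c] by (simp add: algebra_simps)
qed

lemma charge_vector_of_gaps:
  assumes "p \<ge> 1" "(\<Sum>i<p. g i) = - 1" "int p dvd (\<Sum>i<p. int i * g i)"
  shows "\<exists>c \<in> charge_vectors p. \<forall>j<p. gap p c j = g j"
proof -
  obtain q where q: "(\<Sum>i<p. int i * g i) = int p * q" using assms(3) by auto
  \<comment> \<open>By \<open>moment_gap\<close> the last coordinate must be \<open>q\<close>, and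
    then \<open>sum_gap\<close> dictates the others.\<close>
  define s where "s j = (\<Sum>i\<le>j. g i) + 1 + q" for j
  define c where "c = map s [0..<p]"
  have "sum_list c = (\<Sum>j<p. s j)"
    by (simp add: c_def sum_list_sum_nth atLeast0LessThan)
  also have "\<dots> = 0"
    using sum_partial_sums[of g p] assms(2) q by (simp add: s_def sum.distrib algebra_simps)
  finally have "c \<in> charge_vectors p" by (simp add: charge_vectors_def c_def)
  moreover have "gap p c j = g j" if "j < p" for j
  proof (cases j)
    case 0
    have "(\<Sum>i\<le>p - 1. g i) = - 1"
      using assms(1,2) by (cases p) (auto simp: lessThan_Suc_atMost)
    then show ?thesis using 0 that by (simp add: gap_def c_def cyc_pred_def carry_def s_def)
  next
    case (Suc i)
    then show ?thesis using that by (simp add: gap_def c_def cyc_pred_def carry_def s_def)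
  qed
  ultimately show ?thesis by blast
qed

text \<open>The moment of the gaps determines the last coordinate, and their partial sums determine
  the rest relative to it.\<close>

lemma charge_vector_gaps_unique:
  assumes "p \<ge> 1" "c \<in> charge_vectors p" "d \<in> charge_vectors p" "\<And>j. j < p \<Longrightarrow> gap p c j = gap p d j"
  shows "c = d"
proof (rule nth_equalityI)
  show "length c = length d" using assms by (simp add: charge_vectors_def)
  have "(\<Sum>i<p. int i * gap p c i) = (\<Sum>i<p. int i * gap p d i)"
    using assms(4) by (intro sum.cong) auto
  then have "int p * c ! (p - 1) = int p * d ! (p - 1)"
    unfolding moment_gap[OF assms(1,2)] moment_gap[OF assms(1,3)] .
  then have last: "c ! (p - 1) = d ! (p - 1)" using assms(1) by simp
  fix j assume "j < length c"
  then have "j < p" using assms(2) by (simp add: charge_vectors_def)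
  moreover have "(\<Sum>i\<le>j. gap p c i) = (\<Sum>i\<le>j. gap p d i)"
    using assms(4) \<open>j < p\<close> by (intro sum.cong) auto
  ultimately show "c ! j = d ! j" using sum_gap[of j p] last by simp
qed

lemma unraisable_iff_gap:
  "c \<in> unraisable p w \<longleftrightarrow> c \<in> charge_vectors p \<and> (\<forall>j<p. gap p c j + (int w - 1) \<ge> 0)"
  by (auto simp: unraisable_def raisable_def gap_def)

text \<open>Adding \<open>w - 1\<close> to each gap makes the entries nonnegative. It changes the
  sum from -1 to \<open>N\<close> and shifts the moment, a multiple of \<open>p\<close> for the
  gaps, by \<open>(w - 1) * (\<Sum>j<p. j)\<close>.\<close>

lemma unraisable_bij_moment_class:
  fixes p w :: nat
  assumes "p \<ge> 1" "w \<ge> 1" "N + 1 = p * (w - 1)"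
  shows "bij_betw (\<lambda>c. map (\<lambda>j. nat (gap p c j + (int w - 1))) [0..<p])
           (unraisable p w) (moment_class p N ((w - 1) * (\<Sum>j<p. j)))"
    (is "bij_betw ?e _ _")
proof (rule bij_betw_imageI)
  have w: "int (w - 1) = int w - 1" using assms(2) by simp
  have N: "int N = int p * (int w - 1) - 1"
  proof -
    have "int N + 1 = int (p * (w - 1))" using assms(3) by (metis of_nat_1 of_nat_add)
    then show ?thesis unfolding of_nat_mult w by linarith
  qed
  \<comment> \<open>Undoing the shift over the integers turns membership into exactly the two
    conditions that make a sequence the gaps of a charge vector.\<close>
  have class_iff: "e \<in> moment_class p N ((w - 1) * (\<Sum>j<p. j)) \<longleftrightarrow>
      length e = p \<and> (\<Sum>i<p. int (e ! i) - (int w - 1)) = - 1 \<and>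
      int p dvd (\<Sum>i<p. int i * (int (e ! i) - (int w - 1)))" for e
  proof (cases "length e = p")
    case True
    have "sum_list e = N \<longleftrightarrow> int (\<Sum>i<p. e ! i) = int N"
      using True by (simp only: of_nat_eq_iff sum_list_sum_nth atLeast0LessThan)
    also have "\<dots> \<longleftrightarrow> (\<Sum>i<p. int (e ! i) - (int w - 1)) = - 1"
      by (auto simp: sum_subtractf N)
    finally have 1: "sum_list e = N \<longleftrightarrow> (\<Sum>i<p. int (e ! i) - (int w - 1)) = - 1" .
    have "moment e mod p = ((w - 1) * (\<Sum>j<p. j)) mod p \<longleftrightarrow>
        int (moment e) mod int p = int ((w - 1) * (\<Sum>j<p. j)) mod int p"
      by (metis of_nat_mod of_nat_eq_iff)
    also have "\<dots> \<longleftrightarrow> int p dvd int (moment e) - int ((w - 1) * (\<Sum>j<p. j))"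
      by (rule mod_eq_dvd_iff)
    also have "int (moment e) - int ((w - 1) * (\<Sum>j<p. j)) =
        (\<Sum>i<p. int i * (int (e ! i) - (int w - 1)))"
    proof -
      have "(\<Sum>i<p. int i * (int (e ! i) - W)) = (\<Sum>i<p. int i * int (e ! i)) - W * (\<Sum>i<p. int i)" for W
        by (simp add: sum_subtractf right_diff_distrib sum_distrib_left mult.commute)
      then show ?thesis
        unfolding of_nat_mult w using True by (simp add: moment_def)
    qed
    finally show ?thesis using 1 True by (simp add: moment_class_def)
  qed (simp add: moment_class_def)
  have nth_e: "int (?e c ! j) - (int w - 1) = gap p c j" if "c \<in> unraisable p w" "j < p" for c j
    using that by (simp add: unraisable_iff_gap)
  show "inj_on ?e (unraisable p w)"
  proof (rule inj_onI)
    fix c d assume cd: "c \<in> unraisable p w" "d \<in> unraisable p w" "?e c = ?e d"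
    show "c = d"
    proof (rule charge_vector_gaps_unique[OF assms(1)])
      show "gap p c j = gap p d j" if "j < p" for j
        using nth_e[OF cd(1) that] nth_e[OF cd(2) that] unfolding cd(3) by (rule trans[OF sym])
    qed (use cd in \<open>simp_all add: unraisable_iff_gap\<close>)
  qed
  show "?e ` unraisable p w = moment_class p N ((w - 1) * (\<Sum>j<p. j))"
  proof (intro equalityI subsetI)
    fix e assume "e \<in> ?e ` unraisable p w"
    then obtain c where c: "c \<in> unraisable p w" "e = ?e c" by auto
    then have "c \<in> charge_vectors p" by (simp add: unraisable_iff_gap)
    then show "e \<in> moment_class p N ((w - 1) * (\<Sum>j<p. j))"
      unfolding class_iff c(2)
      using sum_gap_all[OF assms(1), of c] moment_gap[OF assms(1), of c] nth_e[OF c(1)]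
      by (simp del: nth_map)
  next
    fix e assume e: "e \<in> moment_class p N ((w - 1) * (\<Sum>j<p. j))"
    then obtain c where c: "c \<in> charge_vectors p" "\<forall>j<p. gap p c j = int (e ! j) - (int w - 1)"
      using charge_vector_of_gaps[OF assms(1), of "\<lambda>j. int (e ! j) - (int w - 1)"]
      unfolding class_iff by blast
    then have "c \<in> unraisable p w" by (simp add: unraisable_iff_gap)
    moreover have "e = ?e c"
      using e c by (intro nth_equalityI) (auto simp: moment_class_def)
    ultimately show "e \<in> ?e ` unraisable p w" by blast
  qed
qed

lemma card_unraisable:
  assumes "p \<ge> 2" "w \<ge> 1"
  shows "finite (unraisable p w)" "p * card (unraisable p w) = (p * w - 2) choose (p - 1)"
proof -
  have "finite (unraisable p w) \<and> p * card (unraisable p w) = (p * w - 2) choose (p - 1)"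
  proof (cases "w = 1")
    case True
    \<comment> \<open>Here \<open>N\<close> would be -1: all gaps would be nonnegative although they
      sum to -1. The binomial coefficient vanishes as well, since
      \<open>p - 2 < p - 1\<close>.\<close>
    have "unraisable p w = {}"
    proof (rule ccontr)
      assume "unraisable p w \<noteq> {}"
      then obtain c where "\<forall>j<p. gap p c j \<ge> 0" using True by (auto simp: unraisable_iff_gap)
      then have "(\<Sum>i<p. gap p c i) \<ge> 0" by (intro sum_nonneg) auto
      then show False using sum_gap_all[of p c] assms(1) by simp
    qed
    then show ?thesis using True assms(1) by simp
  next
    case False
    define v where "v = w - 2"
    have v: "w = Suc (Suc v)" using False assms(2) unfolding v_def by linarith
    define N where "N = p * (w - 1) - 1"
    have N: "N + 1 = p * (w - 1)" using assms(1) by (simp add: N_def v)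
    note bij = unraisable_bij_moment_class[OF _ assms(2) N]
    have "p * card (unraisable p w) = (N + p - 1) choose N"
      using bij_betw_same_card[OF bij] card_moment_class[of p N] assms(1) N by simp
    also have "\<dots> = (N + p - 1) choose (p - 1)"
      using binomial_symmetric[of N "N + p - 1"] assms(1) by simp
    also have "N + p - 1 = p * w - 2"
      using assms(1) by (simp add: N_def v)
    finally show ?thesis
      using bij_betw_finite[OF bij] finite_moment_class assms(1) by simp
  qed
  then show "finite (unraisable p w)" "p * card (unraisable p w) = (p * w - 2) choose (p - 1)"
    by auto
qed

theorem theorem4p15:
  fixes p w :: nat
  assumes "prime p" and "w \<ge> 1"
  shows "finite {F \<in> scopes_families p w. finite F} \<and>
         real (card {F \<in> scopes_families p w. finite F})
           = 1 / real p * real ((p * w - 2) choose (p - 1))"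
proof -
  have p: "p \<ge> 2" using assms(1) by (rule prime_ge_2_nat)
  note bij = finite_families_bij[OF p assms(2)]
  have "real p * real (card {F \<in> scopes_families p w. finite F}) = real ((p * w - 2) choose (p - 1))"
    using card_unraisable(2)[OF p assms(2)] bij_betw_same_card[OF bij] by (metis of_nat_mult)
  then show ?thesis
    using bij_betw_finite[OF bij] card_unraisable(1)[OF p assms(2)] p
    by (simp add: field_simps)
qed

end
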